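(* Let $d\geq 2$, let $L$ be a positive even integer, and consider the torus $\mathbb{T}_L=\mathbb{Z}^d/L\mathbb{Z}^d$ with nearest-neighbour edges. Let $i\in\{1,\dots,d\}$, $N\in\mathbb{N}_{>0}$, $\beta\geq 0$, and let $\langle\varphi_o\cdot\varphi_z\rangle_{L,N,\beta}$ be the spin-spin correlation of the spin $O(N)$ model on $\mathbb{T}_L$ at inverse temperature $\beta$. Then for every $z=(z_1,\dots,z_d)\in\mathbb{T}_L$, $$\langle\varphi_o\cdot\varphi_z\rangle_{L,N,\beta}\leq\langle\varphi_o\cdot\varphi_{z_i\boldsymbol{e}_i}\rangle_{L,N,\beta}.$$ Moreover, for every $y\in\mathbb{T}_L$ with $y\cdot\boldsymbol{e}_i=0$ (possibly $y=o$), the function $$n\mapsto\langle\varphi_o\cdot\varphi_{y+n\boldsymbol{e}_i}\rangle_{L,N,\beta}+\langle\varphi_o\cdot\varphi_{n\boldsymbol{e}_i}\rangle_{L,N,\beta}$$ is a non-increasing function of $n$ for integers $n$ in $(0,L/2]$.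
   Context: Spin $O(N)$ model. Let $\mathcal{G}=(\mathcal{V},\mathcal{E})$ be a finite simple undirected graph and $N\in\mathbb{N}_{>0}$. Spin configurations are $\varphi=(\varphi_x)_{x\in\mathcal{V}}\in(\mathbb{S}^{N-1})^{\mathcal{V}}$, where $\mathbb{S}^{N-1}\subset\mathbb{R}^N$ is the unit sphere ($\mathbb{S}^0=\{-1,1\}$). With $H_{\mathcal{G},N}(\varphi)=-\sum_{\{x,y\}\in\mathcal{E}}\varphi_x\cdot\varphi_y$ and $d\varphi_x$ the uniform probability measure on $\mathbb{S}^{N-1}$, define $$\langle f\rangle_{\mathcal{G},N,\beta}=\frac{\big(\prod_{x\in\mathcal{V}}\int_{\mathbb{S}^{N-1}}d\varphi_x\big)f(\varphi)e^{-\beta H_{\mathcal{G},N}(\varphi)}}{\big(\prod_{x\in\mathcal{V}}\int_{\mathbb{S}^{N-1}}d\varphi_x\big)e^{-\beta H_{\mathcal{G},N}(\varphi)}}.$$ When $\mathcal{G}$ is the torus $\mathbb{T}_L$ with nearest-neighbour edges one writes $\langle\cdot\rangle_{L,N,\beta}$. The torus is identified with $[0,L)^d\cap\mathbb{Z}^d$ (coordinates mod $L$); $o=(0,\dots,0)$; $\boldsymbol{e}_i$ are the cartesian unit vectors; $y\cdot\boldsymbol{e}_i$ is the $i$-th coordinate of $y$. *)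

theory Defs
  imports "HOL-Probability.Probability"
begin

section \<open>The uniform probability measure on the unit sphere\<close>

text \<open>
  The sphere of dimension \<open>N - 1\<close>, with \<open>N = CARD('n)\<close>, carries the image of the normalised
  Lebesgue measure of the unit ball under radial projection (the normalised cone measure).
  For \<open>N = 1\<close> this gives mass \<open>1/2\<close> to each of the two points of the sphere. The projection
  sends the origin to itself; that point is a null set and is cut off by \<open>restrict_space\<close>.
\<close>

definition sphere_uniform :: "(real^'n) measure" where
  "sphere_uniform =
     restrict_space
       (distr (uniform_measure lborel (ball 0 1)) borel (\<lambda>x. x /\<^sub>R norm x))
       (sphere 0 1)"

lemma space_sphere_uniform [simp]: "space sphere_uniform = sphere (0 :: real^'n) 1"
  by (simp add: sphere_uniform_def space_restrict_space)

lemma sets_sphere_uniform: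
  "sets sphere_uniform = sets (restrict_space borel (sphere (0 :: real^'n) 1))"
  unfolding sphere_uniform_def by (rule sets_restrict_space_cong) simp

lemma emeasure_ball_pos_finite:
  "emeasure lborel (ball (0 :: real^'n) 1) \<noteq> 0" "emeasure lborel (ball (0 :: real^'n) 1) \<noteq> \<infinity>"
proof -
  show "emeasure lborel (ball (0 :: real^'n) 1) \<noteq> 0"
    using content_ball_pos[of 1 "0 :: real^'n"] by (auto simp: measure_def)
  show "emeasure lborel (ball (0 :: real^'n) 1) \<noteq> \<infinity>"
    using emeasure_lborel_ball_finite[of "0 :: real^'n" 1] by simp
qed

lemma emeasure_sphere_uniform:
  fixes A :: "(real^'n) set"
  assumes "A \<in> sets borel" "A \<subseteq> sphere 0 1"
  shows "emeasure sphere_uniform A =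
    emeasure lborel {x \<in> ball 0 1. x /\<^sub>R norm x \<in> A} / emeasure lborel (ball (0 :: real^'n) 1)"
proof -
  have [measurable]: "A \<in> sets borel" by fact
  have "emeasure sphere_uniform A =
      emeasure (distr (uniform_measure lborel (ball 0 1)) borel (\<lambda>x. x /\<^sub>R norm x)) A"
    unfolding sphere_uniform_def using assms by (subst emeasure_restrict_space) auto
  also have "\<dots> = emeasure (uniform_measure lborel (ball 0 1)) {x. x /\<^sub>R norm x \<in> A}"
    by (subst emeasure_distr) (simp_all add: vimage_def)
  also have "\<dots> = emeasure lborel (ball 0 1 \<inter> {x. x /\<^sub>R norm x \<in> A}) /
      emeasure lborel (ball (0 :: real^'n) 1)"
  proof (subst emeasure_uniform_measure)
    have "(\<lambda>x :: real^'n. x /\<^sub>R norm x) -` A \<inter> space borel \<in> sets borel"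
      by measurable
    then show "{x :: real^'n. x /\<^sub>R norm x \<in> A} \<in> sets lborel"
      by (simp add: vimage_def)
  qed auto
  also have "ball 0 1 \<inter> {x. x /\<^sub>R norm x \<in> A} = {x \<in> ball 0 1. x /\<^sub>R norm x \<in> A}"
    by auto
  finally show ?thesis .
qed

lemma prob_space_sphere_uniform: "prob_space (sphere_uniform :: (real^'n) measure)"
proof
  have eq: "{x \<in> ball 0 1. x /\<^sub>R norm x \<in> sphere (0 :: real^'n) 1} = ball 0 1 - {0}"
    by auto
  have "emeasure sphere_uniform (sphere (0 :: real^'n) 1) =
      emeasure lborel (ball (0 :: real^'n) 1 - {0}) / emeasure lborel (ball (0 :: real^'n) 1)"
    by (subst emeasure_sphere_uniform) (simp_all only: eq, auto)
  also have "emeasure lborel (ball (0 :: real^'n) 1 - {0}) = emeasure lborel (ball (0 :: real^'n) 1)"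
    by (rule emeasure_Diff_null_set) auto
  finally show "emeasure sphere_uniform (space (sphere_uniform :: (real^'n) measure)) = 1"
    using emeasure_ball_pos_finite[where 'n='n] by (simp add: less_top)
qed

text \<open>
  Rotation invariance, which characterises the uniform probability measure on the sphere. The sort
  \<open>wellorder\<close> comes from the library's transformation formula for Lebesgue measure.
\<close>

lemma sphere_uniform_orthogonal_image:
  fixes f :: "real^'n::{finite,wellorder} \<Rightarrow> real^'n::_" and A :: "(real^'n::_) set"
  assumes f: "orthogonal_transformation f" and A: "A \<in> sets borel" "A \<subseteq> sphere 0 1"
  shows "measure sphere_uniform (f ` A) = measure sphere_uniform A"
proof -
  have nf: "norm (f x) = norm x" for x
    using f by (simp add: orthogonal_transformation_norm)
  have linf: "linear f" and injf: "inj f" and bijf: "bij f"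
    using f by (auto simp: orthogonal_transformation_linear orthogonal_transformation_inj
        orthogonal_transformation_bij)
  have inv: "orthogonal_transformation (inv f)"
    using f by (rule orthogonal_transformation_inv)
  have "inv f \<in> borel_measurable borel"
    using inv by (intro borel_measurable_continuous_onI linear_continuous_on)
       (simp add: linear_linear orthogonal_transformation_linear)
  then have "inv f -` A \<inter> space borel \<in> sets borel"
    using A(1) by (rule measurable_sets)
  then have fA: "f ` A \<in> sets borel"
    using bijf by (simp add: bij_vimage_eq_inv_image bij_imp_bij_inv inv_inv_eq)
  have fA': "f ` A \<subseteq> sphere 0 1"
    using A(2) nf by auto
  let ?C = "\<lambda>B :: (real^'n::_) set. {x \<in> ball 0 1. x /\<^sub>R norm x \<in> B}"
  have C: "?C B \<in> sets borel" if [measurable]: "B \<in> sets borel" for B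
    by measurable
  have "?C (f ` A) = f ` ?C A"
  proof (intro equalityI subsetI)
    fix x assume x: "x \<in> ?C (f ` A)"
    obtain w where w: "x = f w" using bijf by (metis bij_pointE)
    have "x /\<^sub>R norm x = f (w /\<^sub>R norm w)"
      using linf by (simp add: w nf linear_scale)
    then have "w /\<^sub>R norm w \<in> A"
      using x injf by (auto simp: inj_image_mem_iff)
    then show "x \<in> f ` ?C A" using x w nf by auto
  next
    fix x assume "x \<in> f ` ?C A"
    then obtain w where w: "x = f w" "norm w < 1" "w /\<^sub>R norm w \<in> A" by auto
    have "x /\<^sub>R norm x = f (w /\<^sub>R norm w)"
      using linf by (simp add: w nf linear_scale)
    then show "x \<in> ?C (f ` A)" using w nf by auto
  qed
  moreover have "measure lebesgue (f ` ?C A) = measure lebesgue (?C A)"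
  proof (rule measure_orthogonal_image[OF f])
    show "?C A \<in> lmeasurable"
      by (rule bounded_set_imp_lmeasurable)
         (use C[OF A(1)] in \<open>auto intro: bounded_subset[OF bounded_ball[of 0 1]]\<close>)
  qed
  ultimately have "measure lborel (?C (f ` A)) = measure lborel (?C A)"
    using C[OF A(1)] C[OF fA] by (simp add: measure_def)
  moreover have "emeasure lborel (?C B) \<noteq> \<infinity>" for B
  proof -
    have "?C B \<subseteq> ball 0 1" by auto
    from emeasure_mono[OF this, of lborel] show ?thesis
      using emeasure_ball_pos_finite[where 'n='n] by (auto simp: top_unique)
  qed
  ultimately have "emeasure lborel (?C (f ` A)) = emeasure lborel (?C A)"
    by (simp add: emeasure_eq_ennreal_measure)
  then show ?thesis
    using A fA fA' by (simp add: measure_def emeasure_sphere_uniform)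
qed


section \<open>The spin \<open>O(N)\<close> model on a finite graph\<close>

text \<open>
  A finite simple graph is given by its finite vertex set \<open>V\<close> and its set \<open>E\<close> of edges, each edge
  being a two-element subset of \<open>V\<close>. A spin configuration is an element of
  \<open>\<Pi>\<^sub>E x\<in>V. sphere 0 1\<close>, the space of the product measure \<open>spin_measure V\<close>.
\<close>

definition simple_graph :: "'v set \<Rightarrow> 'v set set \<Rightarrow> bool" where
  "simple_graph V E \<longleftrightarrow> finite V \<and> (\<forall>e\<in>E. e \<subseteq> V \<and> card e = 2)"

definition edge_inner :: "('v \<Rightarrow> real^'n) \<Rightarrow> 'v set \<Rightarrow> real" where
  "edge_inner \<phi> e = (THE r. \<exists>x y. e = {x, y} \<and> r = \<phi> x \<bullet> \<phi> y)"

lemma edge_inner_doubleton: "edge_inner \<phi> {x, y} = \<phi> x \<bullet> \<phi> y"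
  unfolding edge_inner_def
  by (rule the_equality) (auto simp: doubleton_eq_iff inner_commute)

definition hamiltonian :: "'v set set \<Rightarrow> ('v \<Rightarrow> real^'n) \<Rightarrow> real" where
  "hamiltonian E \<phi> = - (\<Sum>e\<in>E. edge_inner \<phi> e)"

definition spin_measure :: "'v set \<Rightarrow> ('v \<Rightarrow> real^'n) measure" where
  "spin_measure V = (\<Pi>\<^sub>M x\<in>V. sphere_uniform)"

definition spin_expectation ::
  "'v set \<Rightarrow> 'v set set \<Rightarrow> real \<Rightarrow> (('v \<Rightarrow> real^'n) \<Rightarrow> real) \<Rightarrow> real" where
  "spin_expectation V E \<beta> f =
     (LINT \<phi>|spin_measure V. f \<phi> * exp (- \<beta> * hamiltonian E \<phi>)) /
     (LINT \<phi> :: 'v \<Rightarrow> real^'n|spin_measure V. exp (- \<beta> * hamiltonian E \<phi>))"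


section \<open>The discrete torus\<close>

text \<open>
  The torus of side length \<open>L\<close> and dimension \<open>CARD('d)\<close> is represented by the integer points
  of \<open>[0, L)\<^sup>d\<close>; neighbours are computed modulo \<open>L\<close>. For \<open>L = 2\<close> the two unit steps in a
  coordinate direction lead to the same vertex, giving a single edge.
\<close>

definition torus :: "int \<Rightarrow> (int^'d) set" where
  "torus L = {x. \<forall>k. 0 \<le> x $ k \<and> x $ k < L}"

definition torus_edges :: "int \<Rightarrow> (int^'d) set set" where
  "torus_edges L = {{x, y} | x y. x \<in> torus L \<and> y \<in> torus L \<and> x \<noteq> y \<and>
     (\<exists>j. y = (\<chi> k. (x + axis j 1) $ k mod L))}"

lemma finite_torus: "finite (torus L :: (int^'d) set)"
proof -
  have "vec_nth ` (torus L :: (int^'d) set) \<subseteq> Pi\<^sub>E UNIV (\<lambda>_. {0..<L})"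
    by (auto simp: torus_def)
  moreover have "finite (Pi\<^sub>E (UNIV :: 'd set) (\<lambda>_. {0..<L}))"
    by (intro finite_PiE) auto
  ultimately show ?thesis
    using finite_subset by (metis (mono_tags) finite_imageD injI vec_nth_inject inj_on_subset subset_UNIV)
qed

lemma simple_graph_torus: "simple_graph (torus L :: (int^'d) set) (torus_edges L)"
  by (auto simp: simple_graph_def finite_torus torus_edges_def)

text \<open>
  The spin-spin correlation between \<open>x\<close> and \<open>y\<close> for spins in \<open>\<real>\<^sup>N\<close>, \<open>N = CARD('n)\<close>. The type argument
  fixes \<open>'n\<close>, which does not occur in the types of the other arguments or of the result.
\<close>

definition torus_correlation ::
  "'n::finite itself \<Rightarrow> int \<Rightarrow> real \<Rightarrow> int^'d \<Rightarrow> int^'d \<Rightarrow> real" where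
  "torus_correlation _ L \<beta> x y =
     spin_expectation (torus L) (torus_edges L) \<beta> (\<lambda>\<phi> :: int^'d \<Rightarrow> real^'n. \<phi> x \<bullet> \<phi> y)"

end

theory Submission
  imports Defs
begin

text \<open>
  The proof is reflection positivity. Let \<open>\<theta>\<close> be a reflection of the torus and \<open>H\<close> the half in
  front of its mirrors. Once the Boltzmann weight is split into a factor seen by \<open>H\<close>, the same
  factor seen through \<open>\<theta>\<close>, and \<open>exp (\<beta> * \<phi> x \<bullet> \<phi> (\<theta> x))\<close> for each edge crossing a mirror, expanding the
  last exponential writes the weight as a limit of sums of terms \<open>h(\<phi>) * h(\<theta> \<phi>)\<close> with \<open>h\<close>
  depending on \<open>H\<close> only, all with nonnegative coefficients because \<open>\<beta> \<ge> 0\<close>. Under the product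
  measure, \<open>g(\<phi>) * g(\<theta> \<phi>)\<close> has a nonnegative integral, because given the spins on the mirrors the
  two sides are independent copies of each other (\<open>integral_reflected_square_nonneg\<close>); by the
  expansion it also does under the Gibbs weight (\<open>reflection_positive_gibbs_weight\<close>). With \<open>g\<close> a
  linear combination of spin coordinates, the matrix of correlations between \<open>x\<close> and \<open>\<theta> y\<close>, for
  \<open>x, y \<in> H\<close>, is positive semidefinite (\<open>correlation_positive_semidefinite\<close>).

  Write \<open>G w n\<close> for the correlation between the origin and \<open>w + n e\<^sub>i\<close>, where \<open>w\<close> has \<open>i\<close>-th
  coordinate \<open>0\<close>. The reflection \<open>x\<^sub>i \<mapsto> c - x\<^sub>i\<close> has its mirrors on sites for \<open>c = 0\<close> and halfway between
  sites for \<open>c = 1\<close>, and correlates \<open>v + a e\<^sub>i\<close> with the image of \<open>w + b e\<^sub>i\<close> by \<open>G (w - v) (a + b - c)\<close>.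
  The vector with entries \<open>1\<close> at \<open>a e\<^sub>i\<close> and \<open>-1\<close> at \<open>w + a e\<^sub>i\<close> then gives \<open>G w n \<le> G 0 n\<close> for
  \<open>n = 2 a - c\<close>; the two values of \<open>c\<close> produce both parities of \<open>n\<close>. This is the first claim. The
  vector with entries \<open>1\<close> at \<open>a e\<^sub>i\<close> and \<open>y + a e\<^sub>i\<close>, and \<open>-1\<close> at the same points moved by \<open>e\<^sub>i\<close>,
  gives convexity of \<open>F n = G y n + G 0 n\<close> on \<open>{0..L}\<close>. The sum over the two layers \<open>0\<close> and \<open>y\<close>
  is what such a vector produces: the diagonal of the form yields \<open>G 0\<close>, the mixed terms \<open>G y\<close>.
  As \<open>F\<close> is symmetric about \<open>L / 2\<close>, convexity makes it non-increasing up to \<open>L / 2\<close>, which is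
  the second claim.
\<close>

section \<open>Bounded measurable functions\<close>

definition bounded_measurable :: "'a measure \<Rightarrow> ('a \<Rightarrow> real) set" where
  "bounded_measurable M = {f \<in> borel_measurable M. \<exists>B. \<forall>x\<in>space M. \<bar>f x\<bar> \<le> B}"

lemma bounded_measurableI:
  "f \<in> borel_measurable M \<Longrightarrow> (\<And>x. x \<in> space M \<Longrightarrow> \<bar>f x\<bar> \<le> B) \<Longrightarrow> f \<in> bounded_measurable M"
  by (auto simp: bounded_measurable_def)

lemma bounded_measurableD: "f \<in> bounded_measurable M \<Longrightarrow> f \<in> borel_measurable M"
  by (simp add: bounded_measurable_def)

lemma bounded_measurableE:
  assumes "f \<in> bounded_measurable M"
  obtains B where "B \<ge> 0" "\<And>x. x \<in> space M \<Longrightarrow> \<bar>f x\<bar> \<le> B"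
proof -
  obtain B where "\<forall>x\<in>space M. \<bar>f x\<bar> \<le> B"
    using assms by (auto simp: bounded_measurable_def)
  then show thesis
    by (intro that[of "max 0 B"]) (auto simp: le_max_iff_disj)
qed

lemma bounded_measurable_const [intro]: "(\<lambda>_. c) \<in> bounded_measurable M"
  by (rule bounded_measurableI[where B = "\<bar>c\<bar>"]) auto

lemma bounded_measurable_add [intro]:
  assumes "f \<in> bounded_measurable M" "g \<in> bounded_measurable M"
  shows "(\<lambda>x. f x + g x) \<in> bounded_measurable M"
proof -
  obtain B C where "\<And>x. x \<in> space M \<Longrightarrow> \<bar>f x\<bar> \<le> B" "\<And>x. x \<in> space M \<Longrightarrow> \<bar>g x\<bar> \<le> C"
    using assms by (metis bounded_measurableE)
  then show ?thesis
    using assms[THEN bounded_measurableD]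
    by (intro bounded_measurableI[where B = "B + C"]) (auto intro: order_trans[OF abs_triangle_ineq] add_mono)
qed

lemma bounded_measurable_mult [intro]:
  assumes "f \<in> bounded_measurable M" "g \<in> bounded_measurable M"
  shows "(\<lambda>x. f x * g x) \<in> bounded_measurable M"
proof -
  obtain B where "\<And>x. x \<in> space M \<Longrightarrow> \<bar>f x\<bar> \<le> B" "B \<ge> 0"
    using assms by (metis bounded_measurableE)
  moreover obtain C where "\<And>x. x \<in> space M \<Longrightarrow> \<bar>g x\<bar> \<le> C"
    using assms by (metis bounded_measurableE)
  ultimately show ?thesis
    using assms[THEN bounded_measurableD]
    by (intro bounded_measurableI[where B = "B * C"]) (auto simp: abs_mult intro!: mult_mono)
qed

lemma bounded_measurable_sum [intro]:
  "(\<And>j. j \<in> J \<Longrightarrow> f j \<in> bounded_measurable M) \<Longrightarrow> (\<lambda>x. \<Sum>j\<in>J. f j x) \<in> bounded_measurable M"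
  by (induction J rule: infinite_finite_induct) auto

lemma bounded_measurable_compose:
  assumes "f \<in> bounded_measurable N" "p \<in> measurable M N"
  shows "(\<lambda>x. f (p x)) \<in> bounded_measurable M"
proof -
  obtain B where "\<And>x. x \<in> space N \<Longrightarrow> \<bar>f x\<bar> \<le> B"
    using assms by (metis bounded_measurableE)
  then show ?thesis
    using assms bounded_measurableD[OF assms(1)] measurable_space[OF assms(2)]
    by (intro bounded_measurableI[where B = B]) auto
qed

lemma bounded_measurable_exp [intro]:
  assumes "f \<in> bounded_measurable M"
  shows "(\<lambda>x. exp (f x)) \<in> bounded_measurable M"
proof -
  obtain B where "\<And>x. x \<in> space M \<Longrightarrow> \<bar>f x\<bar> \<le> B"
    using assms by (metis bounded_measurableE)
  then show ?thesis
    using bounded_measurableD[OF assms]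
    by (intro bounded_measurableI[where B = "exp B"]) (auto simp: abs_le_iff)
qed

lemma (in finite_measure) integrable_bounded_measurable:
  assumes "f \<in> bounded_measurable M"
  shows "integrable M f"
proof -
  obtain B where "\<And>x. x \<in> space M \<Longrightarrow> \<bar>f x\<bar> \<le> B"
    using assms by (metis bounded_measurableE)
  then show ?thesis
    using bounded_measurableD[OF assms] by (intro integrable_const_bound[where B = B]) auto
qed

section \<open>The cone of reflection positive weights\<close>

text \<open>
  An integrable majorant, uniform in the number of terms, for passing to the limit in the exponential series.
\<close>

lemma abs_exp_partial_sum_le:
  fixes x :: real
  shows "\<bar>\<Sum>n<m. x ^ n /\<^sub>R fact n\<bar> \<le> exp \<bar>x\<bar>"
proof -
  have "\<bar>\<Sum>n<m. x ^ n /\<^sub>R fact n\<bar> \<le> (\<Sum>n<m. \<bar>x\<bar> ^ n /\<^sub>R fact n)"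
    by (rule order_trans[OF sum_abs]) (simp add: abs_mult power_abs)
  also have "\<dots> \<le> (\<Sum>n. \<bar>x\<bar> ^ n /\<^sub>R fact n)"
    using exp_converges[of "\<bar>x\<bar>"] by (intro sum_le_suminf) (auto simp: sums_iff)
  also have "\<dots> = exp \<bar>x\<bar>"
    using exp_converges[of "\<bar>x\<bar>"] by (simp add: sums_iff)
  finally show ?thesis .
qed

text \<open>
  A random element \<open>w\<close> is seen through two observables: \<open>p w\<close> is its restriction to one half, and
  \<open>q w\<close> the other half carried over by the reflection. Both thus take values in the same space, and
  one function can be applied to both.
\<close>

locale reflected_pair = finite_measure M for M :: "'a measure" +
  fixes N :: "'b measure" and p q :: "'a \<Rightarrow> 'b"
  assumes p: "p \<in> measurable M N" and q: "q \<in> measurable M N"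
begin

lemma bounded_measurable_p [intro]: "h \<in> bounded_measurable N \<Longrightarrow> (\<lambda>w. h (p w)) \<in> bounded_measurable M"
  and bounded_measurable_q [intro]: "h \<in> bounded_measurable N \<Longrightarrow> (\<lambda>w. h (q w)) \<in> bounded_measurable M"
  by (auto intro: bounded_measurable_compose p q)

text \<open>
  Membership in this cone says that \<open>g \<mapsto> \<integral> g(p) g(q) F\<close> is a nonnegative quadratic form. No
  pointwise positivity of \<open>F\<close> is meant.
\<close>

definition reflection_positive :: "('a \<Rightarrow> real) \<Rightarrow> bool" where
  "reflection_positive F \<longleftrightarrow> F \<in> bounded_measurable M \<and>
     (\<forall>g\<in>bounded_measurable N. 0 \<le> (LINT w|M. g (p w) * g (q w) * F w))"

lemma reflection_positive_integrable:
  assumes "F \<in> bounded_measurable M" "g \<in> bounded_measurable N"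
  shows "integrable M (\<lambda>w. g (p w) * g (q w) * F w)"
  using assms by (intro integrable_bounded_measurable bounded_measurable_mult
      bounded_measurable_p bounded_measurable_q)

lemma reflection_positive_zero: "reflection_positive (\<lambda>_. 0)"
  by (auto simp: reflection_positive_def)

lemma reflection_positive_add:
  assumes "reflection_positive F" "reflection_positive G"
  shows "reflection_positive (\<lambda>w. F w + G w)"
  using assms by (auto simp: reflection_positive_def distrib_left reflection_positive_integrable)

lemma reflection_positive_scale:
  assumes "reflection_positive F" "c \<ge> 0"
  shows "reflection_positive (\<lambda>w. c * F w)"
proof -
  have "(LINT w|M. g (p w) * g (q w) * (c * F w)) = c * (LINT w|M. g (p w) * g (q w) * F w)" for g
    by (simp add: mult.left_commute)
  then show ?thesis
    using assms by (auto simp: reflection_positive_def)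
qed

lemma reflection_positive_sum: "(\<And>j. j \<in> J \<Longrightarrow> reflection_positive (F j)) \<Longrightarrow> reflection_positive (\<lambda>w. \<Sum>j\<in>J. F j w)"
  by (induction J rule: infinite_finite_induct) (auto simp: reflection_positive_zero intro: reflection_positive_add)

text \<open>
  The factor \<open>h(p) h(q)\<close> is absorbed into the test function, which becomes \<open>g h\<close>.
\<close>

lemma reflection_positive_mult_square:
  assumes F: "reflection_positive F" and h: "h \<in> bounded_measurable N"
  shows "reflection_positive (\<lambda>w. F w * (h (p w) * h (q w)))"
  unfolding reflection_positive_def
proof (intro conjI ballI)
  show "(\<lambda>w. F w * (h (p w) * h (q w))) \<in> bounded_measurable M"
    using F h by (intro bounded_measurable_mult bounded_measurable_p bounded_measurable_q) (auto simp: reflection_positive_def)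
  fix g assume "g \<in> bounded_measurable N"
  then have "(\<lambda>x. g x * h x) \<in> bounded_measurable N"
    using h by auto
  then have "0 \<le> (LINT w|M. (g (p w) * h (p w)) * (g (q w) * h (q w)) * F w)"
    using F unfolding reflection_positive_def by fast
  then show "0 \<le> (LINT w|M. g (p w) * g (q w) * (F w * (h (p w) * h (q w))))"
    by (simp add: mult_ac)
qed

text \<open>
  The cone is convex and closed under bounded pointwise limits, so a kernel that preserves it has an
  exponential that preserves it.
\<close>

lemma reflection_positive_mult_exp:
  assumes F: "reflection_positive F" and K: "K \<in> bounded_measurable M"
    and step: "\<And>F. reflection_positive F \<Longrightarrow> reflection_positive (\<lambda>w. F w * K w)"
  shows "reflection_positive (\<lambda>w. F w * exp (K w))"
proof -
  have bF: "F \<in> bounded_measurable M"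
    using F by (simp add: reflection_positive_def)
  have power: "reflection_positive (\<lambda>w. F w * K w ^ n)" for n
  proof (induction n)
    case (Suc n)
    from step[OF this] show ?case by (simp add: mult_ac)
  qed (use F in simp)
  have partial: "reflection_positive (\<lambda>w. F w * (\<Sum>n<m. K w ^ n /\<^sub>R fact n))" for m
  proof -
    have "reflection_positive (\<lambda>w. \<Sum>n<m. inverse (fact n) * (F w * K w ^ n))"
      by (intro reflection_positive_sum reflection_positive_scale power) simp
    then show ?thesis
      by (simp add: sum_distrib_left mult_ac)
  qed
  show ?thesis
    unfolding reflection_positive_def
  proof (intro conjI ballI)
    show "(\<lambda>w. F w * exp (K w)) \<in> bounded_measurable M"
      using bF K by auto
    fix g assume g: "g \<in> bounded_measurable N"
    let ?G = "\<lambda>w. g (p w) * g (q w) * F w"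
    let ?S = "\<lambda>m w. \<Sum>n<m. K w ^ n /\<^sub>R fact n"
    have G: "?G \<in> bounded_measurable M"
      using g bF by (intro bounded_measurable_mult bounded_measurable_p bounded_measurable_q)
    obtain B where B: "B \<ge> 0" "\<And>w. w \<in> space M \<Longrightarrow> \<bar>?G w\<bar> \<le> B"
      using G by (rule bounded_measurableE) auto
    obtain C where C: "C \<ge> 0" "\<And>w. w \<in> space M \<Longrightarrow> \<bar>K w\<bar> \<le> C"
      using K by (rule bounded_measurableE) auto
    have meas: "K \<in> borel_measurable M" "?G \<in> borel_measurable M"
      using K G by (auto dest: bounded_measurableD)
    have "(\<lambda>m. LINT w|M. ?G w * ?S m w) \<longlonglongrightarrow> (LINT w|M. ?G w * exp (K w))"
    proof (rule integral_dominated_convergence[where w = "\<lambda>_. B * exp C"])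
      show "(\<lambda>w. ?G w * exp (K w)) \<in> borel_measurable M"
        "(\<lambda>w. ?G w * ?S m w) \<in> borel_measurable M" for m
        using meas by measurable
      show "AE w in M. (\<lambda>m. ?G w * ?S m w) \<longlonglongrightarrow> ?G w * exp (K w)"
        using exp_converges[unfolded sums_def] by (intro AE_I2 tendsto_mult_left)
      have "\<bar>?G w * ?S m w\<bar> \<le> B * exp C" if "w \<in> space M" for m w
      proof -
        have "\<bar>?S m w\<bar> \<le> exp C"
          using abs_exp_partial_sum_le[of "K w" m] C(2)[OF that]
          by (meson exp_le_cancel_iff order_trans)
        then show ?thesis
          unfolding abs_mult[of "?G w"] using B that by (intro mult_mono) auto
      qed
      then show "AE w in M. norm (?G w * ?S m w) \<le> B * exp C" for m
        by auto
    qed simp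
    moreover have "0 \<le> (LINT w|M. ?G w * ?S m w)" for m
      using partial[of m] g by (auto simp: reflection_positive_def mult_ac)
    ultimately have "0 \<le> (LINT w|M. ?G w * exp (K w))"
      by (intro LIMSEQ_le_const) auto
    then show "0 \<le> (LINT w|M. g (p w) * g (q w) * (F w * exp (K w)))"
      by (simp add: mult_ac)
  qed
qed

lemma reflection_positive_mult_exp_sum_squares:
  assumes F: "reflection_positive F" and h: "\<And>j. j \<in> J \<Longrightarrow> h j \<in> bounded_measurable N" and c: "c \<ge> 0"
  shows "reflection_positive (\<lambda>w. F w * exp (c * (\<Sum>j\<in>J. h j (p w) * h j (q w))))"
proof (rule reflection_positive_mult_exp[OF F])
  show "(\<lambda>w. c * (\<Sum>j\<in>J. h j (p w) * h j (q w))) \<in> bounded_measurable M"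
    using h by (intro bounded_measurable_mult bounded_measurable_const bounded_measurable_sum
      bounded_measurable_p bounded_measurable_q)
  fix F assume "reflection_positive F"
  then have "reflection_positive (\<lambda>w. c * (\<Sum>j\<in>J. F w * (h j (p w) * h j (q w))))"
    using h c by (intro reflection_positive_scale reflection_positive_sum reflection_positive_mult_square) auto
  then show "reflection_positive (\<lambda>w. F w * (c * (\<Sum>j\<in>J. h j (p w) * h j (q w))))"
    by (simp add: sum_distrib_left mult_ac)
qed

end

section \<open>Spin observables and graph automorphisms\<close>

lemma measurable_spin_component:
  assumes "x \<in> V"
  shows "(\<lambda>\<phi>. \<phi> x) \<in> measurable (spin_measure V) (borel :: (real^'n) measure)"
proof -
  have "(\<lambda>u. u) \<in> measurable sphere_uniform (borel :: (real^'n) measure)"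
    unfolding measurable_cong_sets[OF sets_sphere_uniform refl]
    by (rule measurable_restrict_space1) simp
  with measurable_component_singleton[OF assms] show ?thesis
    unfolding spin_measure_def by (rule measurable_compose)
qed

lemma prob_space_spin_measure: "prob_space (spin_measure V :: ('v \<Rightarrow> real^'n) measure)"
  unfolding spin_measure_def by (intro prob_space_PiM prob_space_sphere_uniform)

lemma norm_spin: "\<phi> \<in> space (spin_measure V) \<Longrightarrow> x \<in> V \<Longrightarrow> norm (\<phi> x) = 1"
  by (auto simp: spin_measure_def space_PiM PiE_iff)

lemma bounded_measurable_spin_nth:
  assumes "x \<in> V"
  shows "(\<lambda>\<phi>. \<phi> x $ k) \<in> bounded_measurable (spin_measure V :: ('v \<Rightarrow> real^'n) measure)"
proof (rule bounded_measurableI)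
  show "(\<lambda>\<phi>. \<phi> x $ k) \<in> borel_measurable (spin_measure V :: ('v \<Rightarrow> real^'n) measure)"
    using measurable_spin_component[OF assms]
    by (rule measurable_compose) (intro borel_measurable_continuous_onI continuous_intros)
  show "\<bar>\<phi> x $ k\<bar> \<le> 1" if "\<phi> \<in> space (spin_measure V)" for \<phi> :: "'v \<Rightarrow> real^'n"
    using norm_spin[OF that assms] component_le_norm_cart[of "\<phi> x" k] by simp
qed

lemma bounded_measurable_spin_inner:
  assumes "x \<in> V" "y \<in> V"
  shows "(\<lambda>\<phi>. \<phi> x \<bullet> \<phi> y) \<in> bounded_measurable (spin_measure V :: ('v \<Rightarrow> real^'n) measure)"
  unfolding inner_vec_def inner_real_def
  by (intro bounded_measurable_sum bounded_measurable_mult bounded_measurable_spin_nth assms)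

lemma bounded_measurable_edge_inner:
  assumes "e \<subseteq> V" "card e = 2"
  shows "(\<lambda>\<phi>. edge_inner \<phi> e) \<in> bounded_measurable (spin_measure V :: ('v \<Rightarrow> real^'n) measure)"
proof -
  obtain x y where "e = {x, y}"
    using assms(2) by (auto simp: card_2_iff)
  then show ?thesis
    using assms(1) by (simp add: edge_inner_doubleton bounded_measurable_spin_inner)
qed

lemma bounded_measurable_gibbs_weight:
  assumes "simple_graph V E"
  shows "(\<lambda>\<phi>. exp (- \<beta> * hamiltonian E \<phi>)) \<in> bounded_measurable (spin_measure V :: ('v \<Rightarrow> real^'n) measure)"
proof -
  have "- \<beta> * hamiltonian E \<phi> = \<beta> * (\<Sum>e\<in>E. edge_inner \<phi> e)" for \<phi> :: "'v \<Rightarrow> real^'n"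
    by (simp add: hamiltonian_def)
  moreover have "(\<lambda>\<phi> :: 'v \<Rightarrow> real^'n. \<beta> * (\<Sum>e\<in>E. edge_inner \<phi> e)) \<in> bounded_measurable (spin_measure V)"
    using assms by (intro bounded_measurable_mult bounded_measurable_const bounded_measurable_sum
        bounded_measurable_edge_inner) (auto simp: simple_graph_def)
  ultimately show ?thesis by auto
qed

lemma measurable_spin_reindex:
  fixes f :: "'w \<Rightarrow> 'v"
  assumes "f \<in> I \<rightarrow> K"
  shows "(\<lambda>\<phi>. \<lambda>x\<in>I. \<phi> (f x)) \<in> measurable (spin_measure K) (spin_measure I :: ('w \<Rightarrow> real^'n) measure)"
  unfolding spin_measure_def using assms
  by (intro measurable_restrict measurable_component_singleton) auto

lemma integral_spin_reindex:
  fixes f :: "'w \<Rightarrow> 'v" and g :: "('w \<Rightarrow> real^'n) \<Rightarrow> real"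
  assumes "inj_on f I" "f \<in> I \<rightarrow> K" "g \<in> bounded_measurable (spin_measure I)"
  shows "(LINT \<phi>|spin_measure K. g (\<lambda>x\<in>I. \<phi> (f x))) = (LINT \<phi>|spin_measure I. g \<phi>)"
proof -
  have "spin_measure I = distr (spin_measure K) (spin_measure I) (\<lambda>\<phi> :: 'v \<Rightarrow> real^'n. \<lambda>x\<in>I. \<phi> (f x))"
    unfolding spin_measure_def
    by (rule distr_PiM_reindex[OF prob_space_sphere_uniform assms(1,2), symmetric])
  then have "(LINT \<phi>|spin_measure I. g \<phi>)
      = (LINT \<phi>|distr (spin_measure K) (spin_measure I) (\<lambda>\<phi> :: 'v \<Rightarrow> real^'n. \<lambda>x\<in>I. \<phi> (f x)). g \<phi>)"
    by simp
  also have "\<dots> = (LINT \<phi>|spin_measure K. g (\<lambda>x\<in>I. \<phi> (f x)))"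
    using assms by (intro integral_distr measurable_spin_reindex bounded_measurableD)
  finally show ?thesis by simp
qed

lemma edge_inner_relabel:
  assumes "card e = 2" "e \<subseteq> I"
  shows "edge_inner (\<lambda>x\<in>I. \<phi> (f x)) e = edge_inner \<phi> (f ` e)"
  using assms by (auto simp: card_2_iff edge_inner_doubleton)

text \<open>
  The edge set is finite, so a vertex injection that maps it into itself permutes it.
\<close>

lemma simple_graph_automorphism_image:
  assumes "simple_graph V E" "inj_on f V" "\<And>e. e \<in> E \<Longrightarrow> f ` e \<in> E"
  shows "inj_on ((`) f) E" "(`) f ` E = E"
proof -
  have "E \<subseteq> Pow V" "finite E"
    using assms(1) by (auto simp: simple_graph_def intro: finite_subset[of E "Pow V"])
  then show inj: "inj_on ((`) f) E"
    using assms(2) inj_on_image_Pow inj_on_subset by blast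
  show "(`) f ` E = E"
    by (rule endo_inj_surj) (use \<open>finite E\<close> inj assms(3) in auto)
qed

lemma hamiltonian_relabel:
  assumes "simple_graph V E" "inj_on f V" "\<And>e. e \<in> E \<Longrightarrow> f ` e \<in> E"
  shows "hamiltonian E (\<lambda>x\<in>V. \<phi> (f x)) = hamiltonian E \<phi>"
proof -
  have "(\<Sum>e\<in>E. edge_inner (\<lambda>x\<in>V. \<phi> (f x)) e) = (\<Sum>e\<in>E. edge_inner \<phi> (f ` e))"
    using assms(1) by (intro sum.cong edge_inner_relabel) (auto simp: simple_graph_def)
  also have "\<dots> = (\<Sum>e\<in>(`) f ` E. edge_inner \<phi> e)"
    using simple_graph_automorphism_image(1)[OF assms] by (simp add: sum.reindex)
  finally show ?thesis
    using simple_graph_automorphism_image[OF assms] by (simp add: hamiltonian_def)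
qed

lemma spin_correlation_automorphism:
  assumes G: "simple_graph V E" and f: "inj_on f V" "f \<in> V \<rightarrow> V" "\<And>e. e \<in> E \<Longrightarrow> f ` e \<in> E"
    and xy: "x \<in> V" "y \<in> V"
  shows "spin_expectation V E \<beta> (\<lambda>\<phi> :: 'v \<Rightarrow> real^'n. \<phi> (f x) \<bullet> \<phi> (f y))
    = spin_expectation V E \<beta> (\<lambda>\<phi> :: 'v \<Rightarrow> real^'n. \<phi> x \<bullet> \<phi> y)"
proof -
  let ?F = "\<lambda>\<phi> :: 'v \<Rightarrow> real^'n. \<phi> x \<bullet> \<phi> y * exp (- \<beta> * hamiltonian E \<phi>)"
  have "?F \<in> bounded_measurable (spin_measure V)"
    by (intro bounded_measurable_mult bounded_measurable_spin_inner bounded_measurable_gibbs_weight G xy)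
  then have "(LINT \<phi>|spin_measure V. ?F (\<lambda>x\<in>V. \<phi> (f x))) = (LINT \<phi>|spin_measure V. ?F \<phi>)"
    by (intro integral_spin_reindex f)
  then show ?thesis
    using xy by (simp add: spin_expectation_def hamiltonian_relabel[OF G f(1,3)])
qed

section \<open>Reflections of a graph\<close>

text \<open>
  The vertices of \<open>H\<close> that \<open>\<theta>\<close> maps into \<open>H\<close> lie on the mirror and are fixed. An edge leaving one half
  without lying in the other must join a vertex to its own mirror image. The mirror may
  pass through vertices, through midpoints of edges, or both.
\<close>

locale graph_reflection =
  fixes V :: "'v set" and E :: "'v set set" and \<theta> :: "'v \<Rightarrow> 'v" and H :: "'v set"
  assumes graph: "simple_graph V E"
    and maps: "x \<in> V \<Longrightarrow> \<theta> x \<in> V"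
    and involution: "x \<in> V \<Longrightarrow> \<theta> (\<theta> x) = x"
    and automorphism: "e \<in> E \<Longrightarrow> \<theta> ` e \<in> E"
    and half: "H \<subseteq> V"
    and cover: "x \<in> V \<Longrightarrow> x \<in> H \<or> \<theta> x \<in> H"
    and fixed: "x \<in> H \<Longrightarrow> \<theta> x \<in> H \<Longrightarrow> \<theta> x = x"
    and edges: "e \<in> E \<Longrightarrow> e \<subseteq> H \<or> \<theta> ` e \<subseteq> H \<or> (\<exists>x\<in>H. e = {x, \<theta> x})"
begin

lemma finite_V: "finite V" and finite_E: "finite E"
  and edge_subset: "e \<in> E \<Longrightarrow> e \<subseteq> V" and edge_card: "e \<in> E \<Longrightarrow> card e = 2"
  using graph by (auto simp: simple_graph_def intro: finite_subset[of E "Pow V"])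

lemma inj_on_reflection: "inj_on \<theta> V"
  by (metis inj_onI involution)

text \<open>
  Given the spins on the mirror \<open>S\<close>, the spins on \<open>A\<close> and on its image \<open>B\<close> are independent and, after
  relabelling by \<open>\<theta>\<close>, identically distributed. The conditional expectation of \<open>g(\<phi>) g(\<theta> \<phi>)\<close> is
  therefore a square.
\<close>

lemma integral_reflected_square_nonneg:
  fixes g :: "('v \<Rightarrow> real^'n) \<Rightarrow> real"
  assumes g: "g \<in> bounded_measurable (spin_measure H)"
  shows "0 \<le> (LINT \<phi>|spin_measure V. g (restrict \<phi> H) * g (\<lambda>x\<in>H. \<phi> (\<theta> x)))"
proof -
  define S A B where "S = {x \<in> H. \<theta> x \<in> H}" and "A = H - S" and "B = V - H"
  interpret product_sigma_finite "\<lambda>_ :: 'v. sphere_uniform :: (real^'n) measure"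
    by (simp add: product_sigma_finite_def prob_space_imp_sigma_finite prob_space_sphere_uniform)
  have fin: "finite S" "finite A" "finite B"
    using finite_V finite_subset[OF half] by (auto simp: S_def A_def B_def)
  have sets: "S \<union> (A \<union> B) = V" "S \<inter> (A \<union> B) = {}" "A \<inter> B = {}" "S \<union> A = H"
    using half by (auto simp: S_def A_def B_def)
  let ?f = "\<lambda>\<phi>. g (restrict \<phi> H) * g (\<lambda>x\<in>H. \<phi> (\<theta> x))"
  have int: "integrable (spin_measure I) h" if "h \<in> bounded_measurable (spin_measure I)"
    for I and h :: "('v \<Rightarrow> real^'n) \<Rightarrow> real"
    by (rule finite_measure.integrable_bounded_measurable[OF prob_space.finite_measure[OF prob_space_spin_measure] that])
  have f: "?f \<in> bounded_measurable (spin_measure V)"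
    using half maps
    by (intro bounded_measurable_mult bounded_measurable_compose[OF g] measurable_spin_reindex) auto
  have merge: "(\<lambda>y. merge I J (s, y)) \<in> measurable (spin_measure J) (spin_measure (I \<union> J))"
    if "s \<in> space (spin_measure I)" for I J and s :: "'v \<Rightarrow> real^'n"
    using that measurable_compose[OF measurable_Pair1' measurable_merge]
    unfolding spin_measure_def by blast
  have "(LINT \<phi>|spin_measure V. ?f \<phi>)
      = (LINT s|spin_measure S. LINT y|spin_measure (A \<union> B). ?f (merge S (A \<union> B) (s, y)))"
    using product_integral_fold[OF sets(2) fin(1) finite_UnI[OF fin(2,3)], of ?f] int[OF f]
    unfolding sets(1) spin_measure_def by blast
  also have "\<dots> = (LINT s|spin_measure S. (LINT a|spin_measure A. g (merge S A (s, a)))\<^sup>2)"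
  proof (rule Bochner_Integration.integral_cong[OF refl])
    fix s :: "'v \<Rightarrow> real^'n" assume s: "s \<in> space (spin_measure S)"
    let ?h = "\<lambda>a. g (merge S A (s, a))"
    have h: "?h \<in> bounded_measurable (spin_measure A)"
      using merge[OF s, of A] unfolding sets(4) by (rule bounded_measurable_compose[OF g])
    have "integrable (spin_measure (A \<union> B)) (\<lambda>y. ?f (merge S (A \<union> B) (s, y)))"
      using merge[OF s, of "A \<union> B"] unfolding sets(1) by (intro int bounded_measurable_compose[OF f])
    then have "(LINT y|spin_measure (A \<union> B). ?f (merge S (A \<union> B) (s, y)))
        = (LINT a|spin_measure A. LINT b|spin_measure B. ?f (merge S (A \<union> B) (s, merge A B (a, b))))"
      unfolding spin_measure_def by (rule product_integral_fold[OF sets(3) fin(2,3)])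
    also have "\<dots> = (LINT a|spin_measure A. LINT b|spin_measure B. ?h a * ?h (\<lambda>x\<in>A. b (\<theta> x)))"
    proof -
      have "restrict (merge S (A \<union> B) (s, merge A B (a, b))) H = merge S A (s, a)"
        for a b :: "'v \<Rightarrow> real^'n"
        using half by (auto simp: merge_def fun_eq_iff S_def A_def B_def)
      moreover have "(\<lambda>x\<in>H. merge S (A \<union> B) (s, merge A B (a, b)) (\<theta> x))
          = merge S A (s, \<lambda>x\<in>A. b (\<theta> x))" for a b :: "'v \<Rightarrow> real^'n"
      proof
        fix x
        consider "x \<in> S" "x \<in> H" "\<theta> x = x" | "x \<in> A" "x \<in> H" "x \<notin> S" "\<theta> x \<in> B" | "x \<notin> H" "x \<notin> S" "x \<notin> A"
          using half maps fixed unfolding S_def A_def B_def by blast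
        then show "(\<lambda>x\<in>H. merge S (A \<union> B) (s, merge A B (a, b)) (\<theta> x)) x
            = merge S A (s, \<lambda>x\<in>A. b (\<theta> x)) x"
        proof cases
          case 2
          moreover have "\<theta> x \<notin> S" "\<theta> x \<notin> A"
            using 2(4) by (auto simp: S_def A_def B_def)
          ultimately show ?thesis by (simp add: merge_def)
        qed (simp_all add: merge_def)
      qed
      ultimately show ?thesis by (simp only:)
    qed
    also have "\<dots> = (LINT a|spin_measure A. ?h a) * (LINT b|spin_measure B. ?h (\<lambda>x\<in>A. b (\<theta> x)))"
      by (simp only: integral_mult_right_zero integral_mult_left_zero)
    also have "(LINT b|spin_measure B. ?h (\<lambda>x\<in>A. b (\<theta> x))) = (LINT a|spin_measure A. ?h a)"
    proof (rule integral_spin_reindex[OF _ _ h])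
      show "inj_on \<theta> A"
        using inj_on_reflection half by (auto simp: A_def intro: inj_on_subset)
      show "\<theta> \<in> A \<rightarrow> B"
        using half maps by (auto simp: A_def B_def S_def)
    qed
    finally show "(LINT y|spin_measure (A \<union> B). ?f (merge S (A \<union> B) (s, y)))
        = (LINT a|spin_measure A. ?h a)\<^sup>2"
      by (simp only: power2_eq_square)
  qed
  also have "\<dots> \<ge> 0"
    by simp
  finally show ?thesis .
qed

sublocale reflected_pair "spin_measure V" "spin_measure H :: ('v \<Rightarrow> real^'n) measure"
  "\<lambda>\<phi>. restrict \<phi> H" "\<lambda>\<phi>. \<lambda>x\<in>H. \<phi> (\<theta> x)"
proof -
  interpret prob_space "spin_measure V :: ('v \<Rightarrow> real^'n) measure"
    by (rule prob_space_spin_measure)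
  show "reflected_pair (spin_measure V) (spin_measure H :: ('v \<Rightarrow> real^'n) measure)
      (\<lambda>\<phi>. restrict \<phi> H) (\<lambda>\<phi>. \<lambda>x\<in>H. \<phi> (\<theta> x))"
    using half maps by unfold_locales (auto intro!: measurable_spin_reindex)
qed

text \<open>
  Edges inside the mirror belong to both halves; each half counts them with weight \<open>1/2\<close>.
\<close>

definition half_energy :: "('v \<Rightarrow> real^'n) \<Rightarrow> real" where
  "half_energy u = (\<Sum>e | e \<in> E \<and> e \<subseteq> H. edge_inner u e)
     - (\<Sum>e | e \<in> E \<and> e \<subseteq> H \<and> \<theta> ` e \<subseteq> H. edge_inner u e) / 2"

lemma hamiltonian_split:
  fixes \<phi> :: "'v \<Rightarrow> real^'n"
  shows "- hamiltonian E \<phi> = half_energy (restrict \<phi> H) + half_energy (\<lambda>x\<in>H. \<phi> (\<theta> x))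
    + (\<Sum>x | x \<in> H \<and> {x, \<theta> x} \<in> E. \<phi> x \<bullet> \<phi> (\<theta> x))"
proof -
  define E1 E2 where "E1 = {e \<in> E. e \<subseteq> H}" and "E2 = {e \<in> E. \<theta> ` e \<subseteq> H}"
  define X where "X = {x \<in> H. {x, \<theta> x} \<in> E}"
  let ?s = "\<lambda>F. \<Sum>e\<in>F. edge_inner \<phi> e"
  have fin: "finite E1" "finite E2" "finite X"
    using finite_E finite_V finite_subset[OF half] by (auto simp: E1_def E2_def X_def)
  have not_fixed: "\<theta> x \<noteq> x" if "x \<in> X" for x
    using that edge_card[of "{x, \<theta> x}"] by (auto simp: X_def)
  have E: "E = (E1 \<union> E2) \<union> (\<lambda>x. {x, \<theta> x}) ` X"
    using edges by (auto simp: E1_def E2_def X_def)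
  \<comment> \<open>An edge in both lists would put \<open>\<theta> x\<close> in \<open>H\<close>, making \<open>x\<close> a fixed point and \<open>{x, \<theta> x}\<close> a loop.\<close>
  have disj: "(E1 \<union> E2) \<inter> (\<lambda>x. {x, \<theta> x}) ` X = {}"
  proof -
    have "{x, \<theta> x} \<notin> E1 \<union> E2" if x: "x \<in> X" for x
    proof
      assume "{x, \<theta> x} \<in> E1 \<union> E2"
      then have "\<theta> x \<in> H"
        by (auto simp: E1_def E2_def)
      then show False
        using fixed[of x] not_fixed[OF x] x by (simp add: X_def)
    qed
    then show ?thesis by blast
  qed
  have inj: "inj_on (\<lambda>x. {x, \<theta> x}) X"
  proof (rule inj_onI)
    fix x y assume "x \<in> X" "y \<in> X" "{x, \<theta> x} = {y, \<theta> y}"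
    then show "x = y"
      using fixed not_fixed by (auto simp: doubleton_eq_iff X_def)
  qed
  have "- hamiltonian E \<phi> = ?s (E1 \<union> E2) + ?s ((\<lambda>x. {x, \<theta> x}) ` X)"
    unfolding hamiltonian_def using fin disj E by (metis (no_types, lifting) finite_UnI finite_imageI minus_minus sum.union_disjoint)
  also have "?s ((\<lambda>x. {x, \<theta> x}) ` X) = (\<Sum>x\<in>X. \<phi> x \<bullet> \<phi> (\<theta> x))"
    by (simp add: sum.reindex[OF inj] edge_inner_doubleton)
  also have "?s (E1 \<union> E2) = ?s E1 + ?s E2 - ?s (E1 \<inter> E2)"
    using sum.union_inter[OF fin(1,2), of "edge_inner \<phi>"] by simp
  also have "?s E2 = (\<Sum>e\<in>E1. edge_inner \<phi> (\<theta> ` e))"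
  proof -
    have img: "\<theta> ` \<theta> ` e = e" if "e \<in> E" for e
      using involution edge_subset[OF that] by (force simp: image_image)
    show ?thesis
      by (rule sum.reindex_bij_witness[where i = "(`) \<theta>" and j = "(`) \<theta>"])
        (use img automorphism in \<open>auto simp: E1_def E2_def\<close>)
  qed
  finally have main: "- hamiltonian E \<phi> = (\<Sum>e\<in>E1. edge_inner \<phi> e) + (\<Sum>e\<in>E1. edge_inner \<phi> (\<theta> ` e))
      - ?s (E1 \<inter> E2) + (\<Sum>x\<in>X. \<phi> x \<bullet> \<phi> (\<theta> x))" by simp
  have half_p: "edge_inner (restrict \<phi> H) e = edge_inner \<phi> e"
    and half_q: "edge_inner (\<lambda>x\<in>H. \<phi> (\<theta> x)) e = edge_inner \<phi> (\<theta> ` e)" if "e \<in> E1" for e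
    using that edge_card edge_inner_relabel[of e H \<phi> "\<lambda>x. x"] edge_inner_relabel[of e H \<phi> \<theta>]
    by (auto simp: E1_def)
  have fixed_edge: "\<theta> ` e = e" if "e \<in> E1 \<inter> E2" for e
    using that fixed by (force simp: E1_def E2_def)
  have sets: "{e. e \<in> E \<and> e \<subseteq> H} = E1" "{e. e \<in> E \<and> e \<subseteq> H \<and> \<theta> ` e \<subseteq> H} = E1 \<inter> E2"
    "{x. x \<in> H \<and> {x, \<theta> x} \<in> E} = X"
    by (auto simp: E1_def E2_def X_def)
  have "half_energy (restrict \<phi> H) = ?s E1 - ?s (E1 \<inter> E2) / 2"
    unfolding half_energy_def sets by (simp add: half_p)
  moreover have "half_energy (\<lambda>x\<in>H. \<phi> (\<theta> x)) = (\<Sum>e\<in>E1. edge_inner \<phi> (\<theta> ` e)) - ?s (E1 \<inter> E2) / 2"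
    unfolding half_energy_def sets using fixed_edge by (simp add: half_q)
  ultimately show ?thesis
    unfolding main sets by simp
qed

text \<open>
  The two half energies contribute a factor \<open>h(p) h(q)\<close>. The crossing edges contribute the exponential
  of a sum of products of a spin coordinate and its mirror image; \<open>\<beta> \<ge> 0\<close> is what keeps that sum in
  the cone.
\<close>

lemma reflection_positive_gibbs_weight:
  assumes "\<beta> \<ge> 0"
  shows "reflection_positive (\<lambda>\<phi> :: 'v \<Rightarrow> real^'n. exp (- \<beta> * hamiltonian E \<phi>))"
proof -
  let ?p = "\<lambda>\<phi> :: 'v \<Rightarrow> real^'n. restrict \<phi> H" and ?q = "\<lambda>\<phi> :: 'v \<Rightarrow> real^'n. \<lambda>x\<in>H. \<phi> (\<theta> x)"
  let ?w = "\<lambda>u :: 'v \<Rightarrow> real^'n. exp (\<beta> * half_energy u)"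
  let ?X = "{x. x \<in> H \<and> {x, \<theta> x} \<in> E}"
  let ?h = "\<lambda>(x, k) u :: 'v \<Rightarrow> real^'n. u x $ k"
  have one: "reflection_positive (\<lambda>_ :: 'v \<Rightarrow> real^'n. 1)"
    by (auto simp: reflection_positive_def integral_reflected_square_nonneg)
  have w: "?w \<in> bounded_measurable (spin_measure H)"
  proof -
    have "half_energy = (\<lambda>u :: 'v \<Rightarrow> real^'n. (\<Sum>e | e \<in> E \<and> e \<subseteq> H. edge_inner u e)
      + (- 1 / 2) * (\<Sum>e | e \<in> E \<and> e \<subseteq> H \<and> \<theta> ` e \<subseteq> H. edge_inner u e))"
      by (auto simp: half_energy_def)
    also have "\<dots> \<in> bounded_measurable (spin_measure H)"
      using edge_card by (intro bounded_measurable_add bounded_measurable_mult bounded_measurable_const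
          bounded_measurable_sum bounded_measurable_edge_inner) auto
    finally show ?thesis
      by (intro bounded_measurable_exp bounded_measurable_mult bounded_measurable_const)
  qed
  have "reflection_positive (\<lambda>\<phi>. 1 * (?w (?p \<phi>) * ?w (?q \<phi>)) *
      exp (\<beta> * (\<Sum>j\<in>?X \<times> UNIV. ?h j (?p \<phi>) * ?h j (?q \<phi>))))"
    by (intro reflection_positive_mult_exp_sum_squares reflection_positive_mult_square one w assms)
      (auto intro: bounded_measurable_spin_nth)
  also have "(\<lambda>\<phi>. 1 * (?w (?p \<phi>) * ?w (?q \<phi>)) *
      exp (\<beta> * (\<Sum>j\<in>?X \<times> UNIV. ?h j (?p \<phi>) * ?h j (?q \<phi>)))) = (\<lambda>\<phi>. exp (- \<beta> * hamiltonian E \<phi>))"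
  proof
    fix \<phi> :: "'v \<Rightarrow> real^'n"
    have "(\<Sum>j\<in>?X \<times> UNIV. ?h j (?p \<phi>) * ?h j (?q \<phi>)) = (\<Sum>x\<in>?X. \<phi> x \<bullet> \<phi> (\<theta> x))"
      by (simp add: sum.cartesian_product' inner_vec_def)
    moreover have "- \<beta> * hamiltonian E \<phi> = \<beta> * (- hamiltonian E \<phi>)"
      by simp
    ultimately show "1 * (?w (?p \<phi>) * ?w (?q \<phi>)) *
      exp (\<beta> * (\<Sum>j\<in>?X \<times> UNIV. ?h j (?p \<phi>) * ?h j (?q \<phi>))) = exp (- \<beta> * hamiltonian E \<phi>)"
      by (simp only: hamiltonian_split distrib_left exp_add mult_1)
  qed
  finally show ?thesis .
qed

text \<open>
  For each coordinate \<open>l\<close> of the spins, the test function is the combination \<open>\<Sum>j. c j * \<phi> (a j) $ l\<close>;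
  adding up over \<open>l\<close> turns products of coordinates into inner products.
\<close>

theorem correlation_positive_semidefinite:
  fixes c :: "'j \<Rightarrow> real" and a :: "'j \<Rightarrow> 'v"
  assumes \<beta>: "\<beta> \<ge> 0" and a: "\<And>j. j \<in> J \<Longrightarrow> a j \<in> H"
  shows "0 \<le> (\<Sum>j\<in>J. \<Sum>k\<in>J. c j * c k *
    spin_expectation V E \<beta> (\<lambda>\<phi> :: 'v \<Rightarrow> real^'n. \<phi> (a j) \<bullet> \<phi> (\<theta> (a k))))"
proof -
  let ?W = "\<lambda>\<phi> :: 'v \<Rightarrow> real^'n. exp (- \<beta> * hamiltonian E \<phi>)"
  let ?p = "\<lambda>\<phi> :: 'v \<Rightarrow> real^'n. restrict \<phi> H" and ?q = "\<lambda>\<phi> :: 'v \<Rightarrow> real^'n. \<lambda>x\<in>H. \<phi> (\<theta> x)"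
  let ?I = "\<lambda>j k. LINT \<phi>|spin_measure V. \<phi> (a j) \<bullet> \<phi> (\<theta> (a k)) * ?W \<phi>"
  let ?g = "\<lambda>l u :: 'v \<Rightarrow> real^'n. \<Sum>j\<in>J. c j * u (a j) $ l"
  have g: "?g l \<in> bounded_measurable (spin_measure H)" for l
    using a by (intro bounded_measurable_sum bounded_measurable_mult bounded_measurable_const
        bounded_measurable_spin_nth)
  have int: "integrable (spin_measure V) (\<lambda>\<phi>. \<phi> (a j) \<bullet> \<phi> (\<theta> (a k)) * ?W \<phi>)"
    if "j \<in> J" "k \<in> J" for j k
    using a[OF that(1)] a[OF that(2)] half maps graph
    by (intro integrable_bounded_measurable bounded_measurable_mult bounded_measurable_spin_inner
        bounded_measurable_gibbs_weight) auto
  have "0 \<le> (\<Sum>l\<in>UNIV. LINT \<phi>|spin_measure V. ?g l (?p \<phi>) * ?g l (?q \<phi>) * ?W \<phi>)"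
    using reflection_positive_gibbs_weight[OF \<beta>] g unfolding reflection_positive_def by (intro sum_nonneg) fast
  also have "\<dots> = (LINT \<phi>|spin_measure V. (\<Sum>l\<in>UNIV. ?g l (?p \<phi>) * ?g l (?q \<phi>) * ?W \<phi>))"
    using reflection_positive_gibbs_weight[OF \<beta>] g
    by (intro Bochner_Integration.integral_sum[symmetric] reflection_positive_integrable) (auto simp: reflection_positive_def)
  also have "\<dots> = (LINT \<phi>|spin_measure V. (\<Sum>j\<in>J. \<Sum>k\<in>J. c j * c k * (\<phi> (a j) \<bullet> \<phi> (\<theta> (a k)) * ?W \<phi>)))"
  proof (rule Bochner_Integration.integral_cong[OF refl])
    fix \<phi> :: "'v \<Rightarrow> real^'n"
    let ?u = "\<Sum>j\<in>J. c j *\<^sub>R \<phi> (a j)" and ?v = "\<Sum>k\<in>J. c k *\<^sub>R \<phi> (\<theta> (a k))"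
    have "?g l (?p \<phi>) = ?u $ l" "?g l (?q \<phi>) = ?v $ l" for l
      using a by simp_all
    then have "(\<Sum>l\<in>UNIV. ?g l (?p \<phi>) * ?g l (?q \<phi>) * ?W \<phi>) = (\<Sum>l\<in>UNIV. ?u $ l * ?v $ l * ?W \<phi>)"
      by (simp only:)
    also have "\<dots> = (?u \<bullet> ?v) * ?W \<phi>"
      unfolding inner_vec_def inner_real_def by (rule sum_distrib_right[symmetric])
    finally have "(\<Sum>l\<in>UNIV. ?g l (?p \<phi>) * ?g l (?q \<phi>) * ?W \<phi>) = (?u \<bullet> ?v) * ?W \<phi>" .
    moreover have "?u \<bullet> ?v = (\<Sum>j\<in>J. \<Sum>k\<in>J. c j * c k * (\<phi> (a j) \<bullet> \<phi> (\<theta> (a k))))"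
      unfolding inner_sum_left inner_sum_right by (subst sum.swap) (simp add: mult_ac)
    ultimately show "(\<Sum>l\<in>UNIV. ?g l (?p \<phi>) * ?g l (?q \<phi>) * ?W \<phi>)
        = (\<Sum>j\<in>J. \<Sum>k\<in>J. c j * c k * (\<phi> (a j) \<bullet> \<phi> (\<theta> (a k)) * ?W \<phi>))"
      by (simp only: sum_distrib_right mult.assoc)
  qed
  also have "\<dots> = (\<Sum>j\<in>J. \<Sum>k\<in>J. c j * c k * ?I j k)"
  proof -
    have "(LINT \<phi>|spin_measure V. (\<Sum>j\<in>J. \<Sum>k\<in>J. c j * c k * (\<phi> (a j) \<bullet> \<phi> (\<theta> (a k)) * ?W \<phi>)))
        = (\<Sum>j\<in>J. LINT \<phi>|spin_measure V. (\<Sum>k\<in>J. c j * c k * (\<phi> (a j) \<bullet> \<phi> (\<theta> (a k)) * ?W \<phi>)))"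
      using int by (intro Bochner_Integration.integral_sum Bochner_Integration.integrable_sum integrable_mult_right)
    also have "\<dots> = (\<Sum>j\<in>J. \<Sum>k\<in>J. LINT \<phi>|spin_measure V. c j * c k * (\<phi> (a j) \<bullet> \<phi> (\<theta> (a k)) * ?W \<phi>))"
      using int by (intro sum.cong refl Bochner_Integration.integral_sum integrable_mult_right)
    finally show ?thesis by (simp only: integral_mult_right_zero)
  qed
  finally have nonneg: "0 \<le> (\<Sum>j\<in>J. \<Sum>k\<in>J. c j * c k * ?I j k)" .
  have "0 \<le> (LINT \<phi>|spin_measure V. ?W \<phi>)"
    by (rule Bochner_Integration.integral_nonneg) (rule exp_ge_zero)
  with nonneg have "0 \<le> (\<Sum>j\<in>J. \<Sum>k\<in>J. c j * c k * ?I j k) / (LINT \<phi>|spin_measure V. ?W \<phi>)"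
    by (rule divide_nonneg_nonneg)
  then show ?thesis
    by (simp only: spin_expectation_def sum_divide_distrib times_divide_eq_right)
qed

end

section \<open>Reflections and translations of the torus\<close>

definition torus_mod :: "int \<Rightarrow> int^'d \<Rightarrow> int^'d" where
  "torus_mod L x = (\<chi> k. x $ k mod L)"

text \<open>
  For \<open>L\<close> even the mirrors lie at \<open>c / 2\<close> and \<open>(c + L) / 2\<close> in direction \<open>i\<close>: through sites if \<open>c\<close>
  is even, halfway between sites if \<open>c\<close> is odd.
\<close>

definition torus_reflect :: "int \<Rightarrow> 'd \<Rightarrow> int \<Rightarrow> int^'d \<Rightarrow> int^'d" where
  "torus_reflect L i c x = (\<chi> k. if k = i then (c - x $ i) mod L else x $ k)"

text \<open>
  The half between the two mirrors, for \<open>c \<in> {0, 1}\<close>. It contains the sites on the mirrors when \<open>c = 0\<close>.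
\<close>

definition half_torus :: "int \<Rightarrow> 'd \<Rightarrow> int \<Rightarrow> (int^'d) set" where
  "half_torus L i c = {x \<in> torus L. c \<le> x $ i \<and> 2 * x $ i \<le> L}"

lemma torus_mod_nth [simp]: "torus_mod L x $ k = x $ k mod L"
  by (simp add: torus_mod_def)

lemma torus_reflect_nth: "torus_reflect L i c x $ k = (if k = i then (c - x $ i) mod L else x $ k)"
  by (simp add: torus_reflect_def)

lemma torus_mod_in_torus: "L > 0 \<Longrightarrow> torus_mod L x \<in> torus L"
  by (simp add: torus_def)

lemma torus_mod_ident: "x \<in> torus L \<Longrightarrow> torus_mod L x = x"
  by (auto simp: torus_def vec_eq_iff)

lemma torus_reflect_in_torus: "L > 0 \<Longrightarrow> x \<in> torus L \<Longrightarrow> torus_reflect L i c x \<in> torus L"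
  by (simp add: torus_def torus_reflect_nth)

lemma torus_reflect_involution:
  assumes "x \<in> torus L"
  shows "torus_reflect L i c (torus_reflect L i c x) = x"
  using assms by (simp add: torus_def vec_eq_iff torus_reflect_nth mod_simps)

lemma torus_edges_iff:
  assumes "L > 0"
  shows "e \<in> torus_edges L \<longleftrightarrow>
    (\<exists>x j. x \<in> torus L \<and> x \<noteq> torus_mod L (x + axis j 1) \<and> e = {x, torus_mod L (x + axis j 1)})"
proof -
  have "e \<in> torus_edges L \<longleftrightarrow> (\<exists>x y. e = {x, y} \<and> x \<in> torus L \<and> y \<in> torus L \<and> x \<noteq> y \<and>
      (\<exists>j. y = torus_mod L (x + axis j 1)))"
    by (simp add: torus_edges_def torus_mod_def)
  then show ?thesis
    using torus_mod_in_torus[OF assms] by blast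
qed

lemma torus_mod_simps:
  "torus_mod L (torus_mod L x + y) = torus_mod L (x + y)"
  "torus_mod L (x + torus_mod L y) = torus_mod L (x + y)"
  "torus_mod L (torus_mod L x - y) = torus_mod L (x - y)"
  "torus_mod L (x - torus_mod L y) = torus_mod L (x - y)"
  by (simp_all add: vec_eq_iff mod_simps)

lemma inj_on_torus_translate: "inj_on (\<lambda>x. torus_mod L (x + t)) (torus L)"
proof (rule inj_onI)
  fix x y assume xy: "x \<in> torus L" "y \<in> torus L" "torus_mod L (x + t) = torus_mod L (y + t)"
  have "torus_mod L (x + t - t) = torus_mod L (y + t - t)"
    using xy(3) torus_mod_simps(3) by metis
  then show "x = y"
    using xy by (simp add: torus_mod_ident)
qed

lemma torus_translate_edge:
  assumes L: "L > 0" and e: "e \<in> torus_edges L"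
  shows "(\<lambda>x. torus_mod L (x + t)) ` e \<in> torus_edges L"
proof -
  let ?f = "\<lambda>x. torus_mod L (x + t)"
  obtain x j where x: "x \<in> torus L" "x \<noteq> torus_mod L (x + axis j 1)"
    and e_eq: "e = {x, torus_mod L (x + axis j 1)}"
    using e torus_edges_iff[OF L] by blast
  have "?f x \<noteq> ?f (torus_mod L (x + axis j 1))"
    using x L inj_onD[OF inj_on_torus_translate] torus_mod_in_torus by metis
  moreover have "?f (torus_mod L (x + axis j 1)) = torus_mod L (?f x + axis j 1)"
    by (simp add: torus_mod_simps add_ac)
  ultimately show ?thesis
    unfolding torus_edges_iff[OF L] e_eq using L torus_mod_in_torus by (intro exI[of _ "?f x"] exI[of _ j]) auto
qed

lemma torus_reflect_edge:
  assumes L: "L > 0" and e: "e \<in> torus_edges L"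
  shows "torus_reflect L i c ` e \<in> torus_edges L"
proof -
  let ?r = "torus_reflect L i c"
  obtain x j where x: "x \<in> torus L" "x \<noteq> torus_mod L (x + axis j 1)"
    and e_eq: "e = {x, torus_mod L (x + axis j 1)}"
    using e torus_edges_iff[OF L] by blast
  let ?y = "torus_mod L (x + axis j 1)"
  have y: "?y \<in> torus L"
    using L by (rule torus_mod_in_torus)
  have ne: "?r x \<noteq> ?r ?y"
    using x y torus_reflect_involution by metis
  show ?thesis
  proof (cases "j = i")
    case True
    \<comment> \<open>The reflection reverses steps in its own direction.\<close>
    have "?r x = torus_mod L (?r ?y + axis i 1)"
      using x(1) True by (auto simp: vec_eq_iff torus_reflect_nth mod_simps axis_def torus_def)
    then show ?thesis
      unfolding torus_edges_iff[OF L] e_eq using ne L y torus_reflect_in_torus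
      by (intro exI[of _ "?r ?y"] exI[of _ i]) auto
  next
    case False
    have "?r ?y = torus_mod L (?r x + axis j 1)"
      using x(1) False by (auto simp: vec_eq_iff torus_reflect_nth mod_simps axis_def torus_def)
    then show ?thesis
      unfolding torus_edges_iff[OF L] e_eq using ne L x torus_reflect_in_torus
      by (intro exI[of _ "?r x"] exI[of _ j]) auto
  qed
qed

lemma reflected_coordinate:
  fixes a c L :: int
  assumes "c \<in> {0, 1}" "0 \<le> a" "a < L" "2 \<le> L"
  shows "(c - a) mod L = (if a \<le> c then c - a else c - a + L)"
proof (cases "a \<le> c")
  case False
  have "(c - a) mod L = (c - a + L) mod L" by simp
  also have "\<dots> = c - a + L"
    using assms False by (intro mod_pos_pos_trivial) auto
  finally show ?thesis using False by simp
qed (use assms in auto)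

lemma next_coordinate:
  fixes a L :: int
  assumes "0 \<le> a" "a < L"
  shows "(a + 1) mod L = (if a + 1 = L then 0 else a + 1)"
  using assms by auto

text \<open>
  For even \<open>L\<close> the two mirrors are both on sites or both halfway between sites, so that an edge either
  stays on one side or is bisected by a mirror.
\<close>

lemma graph_reflection_torus:
  fixes i :: "'d::finite"
  assumes L: "L > 0" "even L" and c: "c \<in> {0, 1}"
  shows "graph_reflection (torus L :: (int^'d) set) (torus_edges L) (torus_reflect L i c) (half_torus L i c)"
proof -
  let ?H = "half_torus L i c" and ?r = "torus_reflect L i c"
  obtain h where h: "L = 2 * h" "h \<ge> 1"
    using L by (auto elim!: evenE)
  have L2: "L \<ge> 2"
    using h by simp
  have in_H: "z \<in> ?H \<longleftrightarrow> c \<le> z $ i \<and> 2 * z $ i \<le> L" if "z \<in> torus L" for z :: "int^'d"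
    using that by (simp add: half_torus_def)
  have bounds: "0 \<le> z $ i" "z $ i < L" if "z \<in> torus L" for z :: "int^'d"
    using that by (auto simp: torus_def)
  have r_in: "?r z \<in> torus L" if "z \<in> torus L" for z
    using that L(1) by (intro torus_reflect_in_torus)
  have r_i: "?r z $ i = (if z $ i \<le> c then c - z $ i else c - z $ i + L)" if "z \<in> torus L" for z
    using reflected_coordinate[OF c bounds[OF that] L2] by (simp add: torus_reflect_nth)
  have cover: "z \<in> ?H \<or> ?r z \<in> ?H" if z: "z \<in> torus L" for z
    using c bounds[OF z] h unfolding in_H[OF z] in_H[OF r_in[OF z]] r_i[OF z] by auto
  have fixed: "?r z = z" if z: "z \<in> ?H" "?r z \<in> ?H" for z
  proof -
    have zt: "z \<in> torus L"
      using z by (simp add: half_torus_def)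
    have "?r z $ i = z $ i"
      using z c bounds[OF zt] h unfolding in_H[OF zt] in_H[OF r_in[OF zt]] r_i[OF zt]
      by (auto split: if_splits)
    then show ?thesis
      by (auto simp: vec_eq_iff torus_reflect_nth)
  qed
  have edges: "e \<subseteq> ?H \<or> ?r ` e \<subseteq> ?H \<or> (\<exists>x\<in>?H. e = {x, ?r x})" if "e \<in> torus_edges L" for e
  proof -
    obtain x j where x: "x \<in> torus L" and e_eq: "e = {x, torus_mod L (x + axis j 1)}"
      using \<open>e \<in> torus_edges L\<close> torus_edges_iff[OF L(1)] by blast
    define y where "y = torus_mod L (x + axis j 1)"
    have e_xy: "e = {x, y}"
      by (simp only: e_eq y_def)
    have y: "y \<in> torus L"
      using L(1) by (simp add: y_def torus_mod_in_torus)
    have rx: "?r x \<in> torus L" and ry: "?r y \<in> torus L"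
      using x y by (auto intro: r_in)
    show "e \<subseteq> ?H \<or> ?r ` e \<subseteq> ?H \<or> (\<exists>x\<in>?H. e = {x, ?r x})"
    proof (cases "j = i")
      case False
      then have "x $ i = y $ i"
        using x by (simp add: y_def axis_def torus_def)
      then have "x \<in> ?H \<longleftrightarrow> y \<in> ?H" "?r x \<in> ?H \<longleftrightarrow> ?r y \<in> ?H"
        using x y rx ry by (auto simp: half_torus_def torus_reflect_nth)
      then show ?thesis
        using cover[OF x] by (auto simp: e_xy)
    next
      case True
      have other: "y $ k = x $ k" if "k \<noteq> i" for k
        using x that True by (simp add: y_def axis_def torus_def)
      define a b where "a = x $ i" and "b = y $ i"
      have a: "0 \<le> a" "a < L" and b: "0 \<le> b" "b < L"
        using x y by (auto simp: a_def b_def torus_def)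
      have "b = (a + 1) mod L"
        using True by (simp add: a_def b_def y_def axis_def)
      then have b_eq: "b = (if a + 1 = L then 0 else a + 1)"
        using next_coordinate[OF a] by simp
      define ra rb where "ra = (c - a) mod L" and "rb = (c - b) mod L"
      have ra_eq: "ra = (if a \<le> c then c - a else c - a + L)"
        and rb_eq: "rb = (if b \<le> c then c - b else c - b + L)"
        unfolding ra_def rb_def using reflected_coordinate c a b L2 by auto
      \<comment> \<open>Besides edges within one half, only \<open>{0, 1}\<close> and \<open>{L / 2, L / 2 + 1}\<close> remain; for \<open>c = 1\<close> they cross a mirror.\<close>
    consider "2 * a + 2 \<le> L" "c \<le> a" | "a = 0" "c = 1" | "2 * a = L" "c = 1" | "L \<le> 2 * a" "2 * a = L \<longrightarrow> c = 0"
        using a c h by fastforce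
      then have "c \<le> a \<and> 2 * a \<le> L \<and> c \<le> b \<and> 2 * b \<le> L
          \<or> c \<le> ra \<and> 2 * ra \<le> L \<and> c \<le> rb \<and> 2 * rb \<le> L
          \<or> c \<le> a \<and> 2 * a \<le> L \<and> b = ra
          \<or> c \<le> b \<and> 2 * b \<le> L \<and> a = rb"
      proof cases
        case 4
        then have "c \<le> ra \<and> 2 * ra \<le> L \<and> c \<le> rb \<and> 2 * rb \<le> L"
          using a c b_eq h unfolding ra_eq rb_eq by auto
        then show ?thesis by blast
      qed (use a c b_eq h in \<open>auto simp: ra_eq rb_eq\<close>)
      then consider "x \<in> ?H" "y \<in> ?H" | "?r x \<in> ?H" "?r y \<in> ?H" | "x \<in> ?H" "b = ra" | "y \<in> ?H" "a = rb"
        using x y rx ry by (auto simp: half_torus_def torus_reflect_nth a_def b_def ra_def rb_def)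
      then show ?thesis
      proof cases
        case 3
        then have "y = ?r x"
          using other by (auto simp: vec_eq_iff torus_reflect_nth a_def b_def ra_def)
        then show ?thesis
          using 3 e_xy by blast
      next
        case 4
        then have "x = ?r y"
          using other by (auto simp: vec_eq_iff torus_reflect_nth a_def b_def rb_def)
        then show ?thesis
          using 4 e_xy by blast
      qed (auto simp: e_xy)
    qed
  qed
  show ?thesis
    using cover fixed edges simple_graph_torus r_in torus_reflect_involution torus_reflect_edge[OF L(1)]
    by (intro graph_reflection.intro) (auto simp: half_torus_def)
qed

section \<open>Correlations along one coordinate direction\<close>

lemma torus_correlation_translate:
  assumes "L > 0" "x \<in> torus L" "y \<in> torus L"
  shows "torus_correlation N L \<beta> (torus_mod L (x + t)) (torus_mod L (y + t)) = torus_correlation N L \<beta> x y"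
  unfolding torus_correlation_def
  using assms torus_mod_in_torus torus_translate_edge
  by (intro spin_correlation_automorphism[OF simple_graph_torus inj_on_torus_translate]) auto

lemma torus_correlation_reflect:
  assumes "L > 0" "x \<in> torus L" "y \<in> torus L"
  shows "torus_correlation N L \<beta> (torus_reflect L i c x) (torus_reflect L i c y) = torus_correlation N L \<beta> x y"
  unfolding torus_correlation_def
  using assms torus_reflect_in_torus torus_reflect_edge
  by (intro spin_correlation_automorphism[OF simple_graph_torus])
    (auto intro!: inj_on_inverseI[where g = "torus_reflect L i c"] torus_reflect_involution)

lemma torus_correlation_commute: "torus_correlation N L \<beta> x y = torus_correlation N L \<beta> y x"
  unfolding torus_correlation_def by (simp add: inner_commute)

lemma torus_correlation_difference:
  assumes "L > 0" "x \<in> torus L" "y \<in> torus L"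
  shows "torus_correlation N L \<beta> x y = torus_correlation N L \<beta> 0 (torus_mod L (y - x))"
proof -
  have "torus_mod L (x + - x) = 0"
    by (simp add: vec_eq_iff)
  then show ?thesis
    using torus_correlation_translate[OF assms, of N \<beta> "- x"] by simp
qed

lemma zero_in_torus: "L > 0 \<Longrightarrow> 0 \<in> torus L"
  by (simp add: torus_def)

text \<open>
  The reduction modulo \<open>L\<close> allows arbitrary integers \<open>n\<close> and differences \<open>w\<close> of torus points, so that
  the symmetries below need no case distinctions.
\<close>

definition layer_correlation :: "'n::finite itself \<Rightarrow> int \<Rightarrow> real \<Rightarrow> 'd \<Rightarrow> int^'d \<Rightarrow> int \<Rightarrow> real" where
  "layer_correlation N L \<beta> i w n = torus_correlation N L \<beta> 0 (torus_mod L (w + axis i n))"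

lemma layer_correlation_minus:
  fixes i :: "'d::finite" and w :: "int^'d"
  assumes "L > 0" "w $ i = 0"
  shows "layer_correlation N L \<beta> i w (- n) = layer_correlation N L \<beta> i w n"
proof -
  have "torus_reflect L i 0 (torus_mod L (w + axis i n)) = torus_mod L (w + axis i (- n))"
    using assms by (auto simp: vec_eq_iff torus_reflect_nth axis_def mod_simps)
  moreover have "torus_reflect L i 0 0 = (0 :: int^'d)"
    by (auto simp: vec_eq_iff torus_reflect_nth)
  ultimately show ?thesis
    using torus_correlation_reflect[OF assms(1) zero_in_torus[OF assms(1)] torus_mod_in_torus[OF assms(1)],
        of N \<beta> i 0 "w + axis i n"]
    by (simp add: layer_correlation_def)
qed

text \<open>
  Inverting the torus changes the signs of both \<open>w\<close> and \<open>n\<close>, and the sign of \<open>n\<close> is immaterial.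
\<close>

lemma layer_correlation_uminus:
  fixes i :: "'d::finite" and w :: "int^'d"
  assumes "L > 0" "w $ i = 0"
  shows "layer_correlation N L \<beta> i (- w) n = layer_correlation N L \<beta> i w n"
proof -
  have "layer_correlation N L \<beta> i w (- n) = torus_correlation N L \<beta> (torus_mod L (w + axis i (- n))) 0"
    unfolding layer_correlation_def by (rule torus_correlation_commute)
  also have "\<dots> = torus_correlation N L \<beta> 0 (torus_mod L (0 - torus_mod L (w + axis i (- n))))"
    using assms by (intro torus_correlation_difference torus_mod_in_torus zero_in_torus)
  also have "torus_mod L (0 - torus_mod L (w + axis i (- n))) = torus_mod L (- w + axis i n)"
    unfolding torus_mod_simps by (simp add: vec_eq_iff axis_def)
  finally have "layer_correlation N L \<beta> i w (- n) = layer_correlation N L \<beta> i (- w) n"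
    by (simp only: layer_correlation_def)
  then show ?thesis
    by (simp add: layer_correlation_minus[where i = i, OF assms])
qed

lemma layer_correlation_period: "layer_correlation N L \<beta> i w (n + L) = layer_correlation N L \<beta> i w n"
proof -
  have "torus_mod L (w + axis i (n + L)) = torus_mod L (w + axis i n)"
    by (auto simp: vec_eq_iff axis_def mod_simps add.assoc[symmetric])
  then show ?thesis by (simp add: layer_correlation_def)
qed

text \<open>
  The reflection turns the difference of the two \<open>i\<close>-th coordinates into a sum, as in a Hankel matrix.
\<close>

lemma torus_correlation_reflected_layers:
  assumes L: "L > 0" and v: "v + axis i a \<in> torus L" "v $ i = 0" and w: "w + axis i b \<in> torus L" "w $ i = 0"
  shows "torus_correlation N L \<beta> (v + axis i a) (torus_reflect L i c (w + axis i b))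
    = layer_correlation N L \<beta> i (w - v) (a + b - c)"
proof -
  have "torus_correlation N L \<beta> (v + axis i a) (torus_reflect L i c (w + axis i b))
      = torus_correlation N L \<beta> 0 (torus_mod L (torus_reflect L i c (w + axis i b) - (v + axis i a)))"
    using L v w by (intro torus_correlation_difference torus_reflect_in_torus)
  also have "torus_mod L (torus_reflect L i c (w + axis i b) - (v + axis i a))
      = torus_mod L ((w - v) + axis i (- (a + b - c)))"
    using v w by (auto simp: vec_eq_iff torus_reflect_nth axis_def mod_simps algebra_simps)
  finally show ?thesis
    using layer_correlation_minus[OF L, of "w - v" i N \<beta> "a + b - c"] v w
    by (simp add: layer_correlation_def)
qed

lemma layer_positive_semidefinite:
  fixes i :: "'d::finite" and w :: "'j \<Rightarrow> int^'d" and a :: "'j \<Rightarrow> int" and r :: "'j \<Rightarrow> real"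
  assumes L: "L > 0" "even L" and \<beta>: "\<beta> \<ge> 0" and c: "c \<in> {0, 1}"
    and w: "\<And>j. j \<in> J \<Longrightarrow> w j \<in> torus L" "\<And>j. j \<in> J \<Longrightarrow> w j $ i = 0"
    and a: "\<And>j. j \<in> J \<Longrightarrow> c \<le> a j" "\<And>j. j \<in> J \<Longrightarrow> 2 * a j \<le> L"
  shows "0 \<le> (\<Sum>j\<in>J. \<Sum>k\<in>J. r j * r k * layer_correlation (N :: 'n::finite itself) L \<beta> i (w k - w j) (a j + a k - c))"
proof -
  interpret graph_reflection "torus L :: (int^'d) set" "torus_edges L" "torus_reflect L i c" "half_torus L i c"
    using L c by (rule graph_reflection_torus)
  have point: "w j + axis i (a j) \<in> torus L" if "j \<in> J" for j
    using w[OF that] a[OF that] c L by (auto simp: torus_def axis_def)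
  have "w j + axis i (a j) \<in> half_torus L i c" if "j \<in> J" for j
    using point[OF that] w[OF that] a[OF that] by (simp add: half_torus_def)
  from correlation_positive_semidefinite[where 'n = 'n and c = r, OF \<beta> this]
  have "0 \<le> (\<Sum>j\<in>J. \<Sum>k\<in>J. r j * r k *
    torus_correlation N L \<beta> (w j + axis i (a j)) (torus_reflect L i c (w k + axis i (a k))))"
    by (simp add: torus_correlation_def)
  also have "\<dots> = (\<Sum>j\<in>J. \<Sum>k\<in>J. r j * r k * layer_correlation N L \<beta> i (w k - w j) (a j + a k - c))"
    using point w L by (intro sum.cong refl) (simp add: torus_correlation_reflected_layers)
  finally show ?thesis .
qed

text \<open>
  Test vector \<open>1\<close> at \<open>a e\<^sub>i\<close>, \<open>-1\<close> at \<open>w + a e\<^sub>i\<close>. The centre of reflection \<open>c\<close> has the parity of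
  \<open>n\<close>, so that \<open>n = 2 a - c\<close> for an integer \<open>a\<close>.
\<close>

lemma layer_correlation_le_axis:
  fixes i :: "'d::finite"
  assumes L: "L > 0" "even L" and \<beta>: "\<beta> \<ge> 0"
    and w: "w \<in> torus L" "w $ i = 0" and n: "0 \<le> n" "n < L"
  shows "layer_correlation N L \<beta> i w n \<le> layer_correlation N L \<beta> i 0 n"
proof -
  define c where "c = n mod 2"
  define a where "a = (n + c) div 2"
  have c: "c = 0 \<or> c = 1" and "2 * a = n + c"
    unfolding a_def c_def by presburger+
  then have a: "c \<in> {0, 1}" "c \<le> a" "2 * a \<le> L" "a + a - c = n"
    using n L(2) by (auto elim!: evenE)
  have "0 \<le> (\<Sum>j\<in>UNIV. \<Sum>k\<in>UNIV. (if j then - 1 else 1) * (if k then - 1 else 1) *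
    layer_correlation N L \<beta> i ((if k then w else 0) - (if j then w else 0)) (a + a - c))"
    using L \<beta> w a by (intro layer_positive_semidefinite) (auto simp: zero_in_torus)
  then show ?thesis
    using a(4) by (simp add: UNIV_bool layer_correlation_uminus[OF L(1) w(2)])
qed

text \<open>
  Test vector \<open>1\<close> on \<open>a e\<^sub>i\<close> and \<open>w + a e\<^sub>i\<close>, \<open>-1\<close> on the same two points at height \<open>a + 1\<close>, where
  \<open>2 a - c = m - 1\<close>. The sums of two heights, less \<open>c\<close>, are then \<open>m - 1\<close>, \<open>m\<close> (twice) and \<open>m + 1\<close>.
  Evenness of \<open>L\<close> keeps height \<open>a + 1\<close> within the half torus.
\<close>

lemma layer_correlation_convex:
  fixes i :: "'d::finite" and N :: "'n::finite itself"
  assumes L: "L > 0" "even L" and \<beta>: "\<beta> \<ge> 0"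
    and w: "w \<in> torus L" "w $ i = 0" and m: "1 \<le> m" "m \<le> L - 1"
  defines "F \<equiv> \<lambda>n. layer_correlation N L \<beta> i w n + layer_correlation N L \<beta> i 0 n"
  shows "2 * F m \<le> F (m - 1) + F (m + 1)"
proof -
  define c where "c = (m - 1) mod 2"
  define a where "a = (m - 1 + c) div 2"
  have c: "c = 0 \<or> c = 1" and two_a: "2 * a = m - 1 + c"
    unfolding a_def c_def by presburger+
  have a: "c \<in> {0, 1}" "c \<le> a" "2 * (a + 1) \<le> L"
    using m L(2) c two_a by (auto elim!: evenE)
  have m_eq: "m = 2 * a + 1 - c"
    using two_a by simp
  let ?w = "\<lambda>j :: bool \<times> bool. if snd j then w else 0"
  let ?a = "\<lambda>j :: bool \<times> bool. if fst j then a + 1 else a"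
  let ?r = "\<lambda>j :: bool \<times> bool. if fst j then - 1 else 1 :: real"
  have "0 \<le> (\<Sum>j\<in>UNIV \<times> UNIV. \<Sum>k\<in>UNIV \<times> UNIV. ?r j * ?r k *
    layer_correlation N L \<beta> i (?w k - ?w j) (?a j + ?a k - c))"
    using L \<beta> w a by (intro layer_positive_semidefinite) (auto simp: zero_in_torus)
  also have "\<dots> = 2 * (F (m - 1) + F (m + 1) - 2 * F m)"
    unfolding sum.cartesian_product' UNIV_bool F_def
    by (simp add: m_eq algebra_simps layer_correlation_uminus[OF L(1) w(2)])
  finally show ?thesis by simp
qed

text \<open>
  The increments of \<open>F\<close> increase, and symmetry makes the increment at \<open>L - 1 - m\<close> the negative of
  the one at \<open>m\<close>. Hence the increment at \<open>m\<close> is at most its own negative whenever \<open>m \<le> L - 1 - m\<close>.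
\<close>

lemma symmetric_convex_antimono:
  fixes F :: "int \<Rightarrow> real"
  assumes convex: "\<And>m. 1 \<le> m \<Longrightarrow> m \<le> L - 1 \<Longrightarrow> 2 * F m \<le> F (m - 1) + F (m + 1)"
    and symmetric: "\<And>m. F (L - m) = F m"
    and n: "0 \<le> n" "n \<le> n'" "2 * n' \<le> L"
  shows "F n' \<le> F n"
proof -
  have incr: "F (m + 1) - F m \<le> F (m' + 1) - F m'" if "m \<le> m'" "0 \<le> m" "m' \<le> L - 1" for m m'
    using that
  proof (induction m' rule: int_ge_induct)
    case (step k)
    then show ?case using convex[of "k + 1"] by simp
  qed simp
  have down: "F (m + 1) \<le> F m" if "0 \<le> m" "2 * m + 2 \<le> L" for m
    using incr[of m "L - 1 - m"] that symmetric[of m] symmetric[of "m + 1"]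
    by (simp add: algebra_simps)
  show ?thesis
    using n(2,3)
  proof (induction n' rule: int_ge_induct)
    case (step k)
    then show ?case using down[of k] n(1) by simp
  qed simp
qed

section \<open>Monotonicity of the spin-spin correlations\<close>

theorem theorem2p7:
  fixes L :: int and i :: "'d::finite" and \<beta> :: real
  assumes "CARD('d) \<ge> 2" and "L > 0" and "even L" and "\<beta> \<ge> 0"
  shows "(\<forall>z \<in> torus L.
            torus_correlation TYPE('n::finite) L \<beta> (0 :: int^'d) z
              \<le> torus_correlation TYPE('n) L \<beta> 0 (axis i (z $ i))) \<and>
         (\<forall>y \<in> torus L. y $ i = 0 \<longrightarrow>
            antimono_on {n :: int. 0 < n \<and> real_of_int n \<le> real_of_int L / 2}
              (\<lambda>n. torus_correlation TYPE('n) L \<beta> (0 :: int^'d) (y + axis i n)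
                 + torus_correlation TYPE('n) L \<beta> 0 (axis i n)))"
proof (intro conjI ballI impI monotone_onI)
  note L = assms(2,3) and \<beta> = assms(4)
  have layer: "layer_correlation TYPE('n) L \<beta> i w n = torus_correlation TYPE('n) L \<beta> 0 (w + axis i n)"
    if "w \<in> torus L" "w $ i = 0" "0 \<le> n" "n < L" for w n
  proof -
    have "w + axis i n \<in> torus L"
      using that by (auto simp: torus_def axis_def)
    then show ?thesis
      by (simp add: layer_correlation_def torus_mod_ident)
  qed
  have zero: "(0 :: int^'d) \<in> torus L"
    using L(1) by (rule zero_in_torus)
  show "torus_correlation TYPE('n) L \<beta> 0 z \<le> torus_correlation TYPE('n) L \<beta> 0 (axis i (z $ i))"
    if z: "z \<in> torus L" for z
  proof -
    define w where "w = z - axis i (z $ i)"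
    have n: "0 \<le> z $ i" "z $ i < L"
      using z by (auto simp: torus_def)
    have w: "w \<in> torus L" "w $ i = 0"
      using z L by (auto simp: torus_def w_def axis_def)
    show ?thesis
      using layer_correlation_le_axis[OF L \<beta> w n, of "TYPE('n)"] layer[OF w n] layer[OF zero _ n]
      by (simp add: w_def)
  qed
  fix y :: "int^'d" and n n' :: int
  assume y: "y \<in> torus L" "y $ i = 0"
    and "n \<in> {n. 0 < n \<and> real_of_int n \<le> real_of_int L / 2}"
    and "n' \<in> {n. 0 < n \<and> real_of_int n \<le> real_of_int L / 2}" and le: "n \<le> n'"
  then have n: "0 < n" "2 * n' \<le> L"
    by auto
  let ?F = "\<lambda>n. layer_correlation TYPE('n) L \<beta> i y n + layer_correlation TYPE('n) L \<beta> i 0 n"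
  have "layer_correlation TYPE('n) L \<beta> i w (L - m) = layer_correlation TYPE('n) L \<beta> i w m"
    if "w $ i = 0" for w m
    using layer_correlation_period[of "TYPE('n)" L \<beta> i w "- m"] layer_correlation_minus[OF L(1) that, of "TYPE('n)" \<beta> m]
    by simp
  then have "?F n' \<le> ?F n"
    using n le y by (intro symmetric_convex_antimono[where F = ?F and L = L] layer_correlation_convex L \<beta>) auto
  then show "torus_correlation TYPE('n) L \<beta> 0 (y + axis i n) + torus_correlation TYPE('n) L \<beta> 0 (axis i n)
      \<ge> torus_correlation TYPE('n) L \<beta> 0 (y + axis i n') + torus_correlation TYPE('n) L \<beta> 0 (axis i n')"
    using layer[OF y, of n] layer[OF y, of n'] layer[OF zero, of n] layer[OF zero, of n'] n le by simp
qed

end
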